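(* Let $\delta_\ell$ be the probability that a growing self-avoiding walk (GSAW) on the bi-infinite triangular ladder $\Delta_\infty$ terminates with length $\ell$, and let $\Delta(x)=\sum_{\ell\ge0}\delta_\ell x^\ell$. Then, as formal power series, $$\Delta(x)=\frac{x^4(2+x)(12+6x-x^3-x^4)}{4(x^2-3)^2(x^4-6x^3+2x^2-30x+36)}.$$
   Context: $\Delta_\infty$ is the graph with vertex set $\{(a,b): a\in\mathbb{Z},\ b\in\{0,1\},\ a+b \text{ even}\}$, where $(x_1,y_1)$ and $(x_2,y_2)$ are adjacent iff ($|x_1-x_2|=1$ and $|y_1-y_2|=1$) or ($y_1=y_2$ and $|x_1-x_2|=2$). All starting vertices are equivalent by symmetry. A growing self-avoiding walk (GSAW) on a graph is the random process that starts at a given vertex and at each step moves to a vertex chosen uniformly at random among the neighbors of the current vertex that have not yet been visited; it terminates (is trapped) when the current vertex has no unvisited neighbor. The length of the walk is the number of steps taken. *)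

theory Defs
  imports
    "HOL-Probability.Probability_Mass_Function"
    "HOL-Computational_Algebra.Formal_Power_Series"
begin

text \<open>
  A graph is given by its vertex set \<open>V\<close> and its adjacency relation \<open>adj\<close>. The history of a walk is
  the nonempty list of visited vertices in reverse order, so that \<open>hd p\<close> is the current vertex and
  the number of steps taken is \<open>length p - 1\<close>.
\<close>

definition unvisited_nbrs :: "'a set \<Rightarrow> ('a \<Rightarrow> 'a \<Rightarrow> bool) \<Rightarrow> 'a list \<Rightarrow> 'a set" where
  "unvisited_nbrs V adj p = {w \<in> V. adj (hd p) w \<and> w \<notin> set p}"

definition trapped :: "'a set \<Rightarrow> ('a \<Rightarrow> 'a \<Rightarrow> bool) \<Rightarrow> 'a list \<Rightarrow> bool" where
  "trapped V adj p \<longleftrightarrow> unvisited_nbrs V adj p = {}"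

text \<open>
  A trapped walk stays unchanged. The graph has to be locally finite: \<open>pmf_of_set\<close> is meaningful
  only for finite nonempty sets.
\<close>

definition gsaw_step :: "'a set \<Rightarrow> ('a \<Rightarrow> 'a \<Rightarrow> bool) \<Rightarrow> 'a list \<Rightarrow> 'a list pmf" where
  "gsaw_step V adj p =
     (if trapped V adj p then return_pmf p
      else map_pmf (\<lambda>w. w # p) (pmf_of_set (unvisited_nbrs V adj p)))"

text \<open>The distribution of the history at time \<open>n\<close> of the growing self-avoiding walk from \<open>v\<close>.\<close>

primrec gsaw :: "'a set \<Rightarrow> ('a \<Rightarrow> 'a \<Rightarrow> bool) \<Rightarrow> 'a \<Rightarrow> nat \<Rightarrow> 'a list pmf" where
  "gsaw V adj v 0 = return_pmf [v]"
| "gsaw V adj v (Suc n) = bind_pmf (gsaw V adj v n) (gsaw_step V adj)"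

text \<open>
  Whether the walk terminates with length \<open>l\<close> is already decided at time \<open>l\<close>: this happens iff
  at that time it has taken \<open>l\<close> steps and is trapped.
\<close>

definition gsaw_length_prob :: "'a set \<Rightarrow> ('a \<Rightarrow> 'a \<Rightarrow> bool) \<Rightarrow> 'a \<Rightarrow> nat \<Rightarrow> real" where
  "gsaw_length_prob V adj v l =
     measure_pmf.prob (gsaw V adj v l) {p. length p = Suc l \<and> trapped V adj p}"

definition tri_ladder_verts :: "(int \<times> int) set" where
  "tri_ladder_verts = {(a, b). b \<in> {0, 1} \<and> even (a + b)}"

definition tri_ladder_adj :: "int \<times> int \<Rightarrow> int \<times> int \<Rightarrow> bool" where
  "tri_ladder_adj = (\<lambda>(x1, y1) (x2, y2).
     (\<bar>x1 - x2\<bar> = 1 \<and> \<bar>y1 - y2\<bar> = 1) \<or> (y1 = y2 \<and> \<bar>x1 - x2\<bar> = 2))"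

end

theory Submission
  imports Defs
begin

text \<open>
  A vertex of the ladder is determined by its first coordinate, and two vertices are adjacent iff
  their first coordinates differ by 1 or 2. So the walk is a growing self-avoiding walk on the
  integers with steps \<open>\<plusminus>1\<close> and \<open>\<plusminus>2\<close>. Two consecutive visited integers form a wall that the walk
  cannot cross.

  Consider the walk at its frontier, say at \<open>n\<close> with everything to the right of \<open>n\<close> unvisited. It can
  advance by 1 or 2. Advancing by 2 leaves a gap at \<open>n + 1\<close>, and a series of such moves leaves a
  chain of gaps in which all other integers are visited. The chain is the only way back: if the walk
  enters it and moves left, then each further step is forced, until the walk is trapped at a wall
  or, if the chain reaches the starting point, escapes into the untouched half-line behind the
  start. There it stands, up to reflection, at a frontier next to a wall. An advance by 1 makes a wall
  of \<open>n\<close> and \<open>n + 1\<close>, so any advance after it leaves the chain behind for good. Hence the past enters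
  the future only through one power series \<open>e\<close>, the generating function of the rest of the walk after
  a retreat into the chain; one more gap at the front end of the chain multiplies \<open>e\<close> by \<open>x\<close>.

  Let \<open>F\<close> and \<open>O\<close> be the generating functions of the remaining length at a frontier next to a wall
  (\<open>fresh\<close>) and at a frontier with one gap in front of a wall (\<open>one_gap\<close>), \<open>G e\<close> the one at a
  frontier behind which there is a longer chain or one that reaches the start (\<open>gapped\<close>), and
  \<open>S e\<close> and \<open>T e\<close> those after an advance by 1 from a frontier with a gap (\<open>sidestep\<close>) and after
  stepping back into the gap (\<open>turn\<close>). Conditioning on the next step gives
  \[ 2F = x(F + O), \quad 3O = x(xF + S(1) + G(1)), \quad 3G(e) = x(T(e) + S(xe) + G(xe)), \]
  \[ 3S(e) = x(e + F + O), \quad 2T(e) = x(F + e). \]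
  Iterating the third equation expresses \<open>G e\<close> by geometric series with ratios \<open>x/3\<close> and
  \<open>x\<^sup>2/3\<close>, so \<open>G e\<close> is affine in \<open>e\<close>, and the remaining equations determine \<open>F\<close> and \<open>O\<close> as
  rational functions. At the start, the first step may be taken to the right by symmetry, and a
  retreat past the start continues with \<open>e = F\<close>. Therefore the series in question is
  \<open>x (S F + G F) / 2\<close>. The combinatorial half of this argument is \<open>line_prob_configs\<close>, which reads
  the equations as recursions for the coefficients; the solution of the system is given by the
  definitions of \<open>fresh_gf\<close>, \<open>one_gap_gf\<close>, \<open>gapped_gf\<close>, \<open>sidestep_gf\<close> and \<open>turn_gf\<close>.
\<close>

unbundle no vec_syntax
unbundle fps_syntax

section \<open>First-step analysis of the growing self-avoiding walk\<close>

definition free_nbrs :: "'a set \<Rightarrow> ('a \<Rightarrow> 'a \<Rightarrow> bool) \<Rightarrow> 'a set \<Rightarrow> 'a \<Rightarrow> 'a set" where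
  "free_nbrs V adj U z = {w \<in> V. adj z w \<and> w \<notin> U}"

text \<open>
  The probability of being trapped after exactly \<open>l\<close> further steps depends on the history only
  through the visited set \<open>U\<close> and the current vertex \<open>z\<close>. Without free neighbours the
  recursive equation reads \<open>0 / 0 = 0\<close>, as it should: a trapped walk makes no further steps.
\<close>

primrec trap_prob :: "'a set \<Rightarrow> ('a \<Rightarrow> 'a \<Rightarrow> bool) \<Rightarrow> nat \<Rightarrow> 'a set \<Rightarrow> 'a \<Rightarrow> real" where
  "trap_prob V adj 0 U z = of_bool (free_nbrs V adj U z = {})"
| "trap_prob V adj (Suc l) U z =
     (\<Sum>w\<in>free_nbrs V adj U z. trap_prob V adj l (insert w U) w) / card (free_nbrs V adj U z)"

lemma unvisited_nbrs_eq_free_nbrs: "unvisited_nbrs V adj p = free_nbrs V adj (set p) (hd p)"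
  by (simp add: unvisited_nbrs_def free_nbrs_def)

context
  fixes V :: "'a set" and adj :: "'a \<Rightarrow> 'a \<Rightarrow> bool"
  assumes locally_finite: "\<And>z. finite {w \<in> V. adj z w}"
begin

lemma finite_unvisited_nbrs: "finite (unvisited_nbrs V adj p)"
  by (rule finite_subset[OF _ locally_finite[of "hd p"]]) (auto simp: unvisited_nbrs_def)

lemma finite_set_gsaw_step: "finite (set_pmf (gsaw_step V adj p))"
  using finite_unvisited_nbrs[of p] by (simp add: gsaw_step_def trapped_def)

lemma finite_set_gsaw: "finite (set_pmf (gsaw V adj v n))"
  by (induction n) (auto simp: finite_set_gsaw_step)

lemma length_gsaw_le: "p \<in> set_pmf (gsaw V adj v n) \<Longrightarrow> length p \<le> Suc n"
proof (induction n arbitrary: p)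
  case (Suc n)
  then obtain q where q: "q \<in> set_pmf (gsaw V adj v n)" "p \<in> set_pmf (gsaw_step V adj q)"
    by auto
  have "length p \<le> Suc (length q)"
    using q(2) finite_unvisited_nbrs[of q]
    by (auto simp: gsaw_step_def trapped_def split: if_splits)
  with Suc.IH[OF q(1)] show ?case by simp
qed simp

text \<open>
  A walk that has been trapped earlier has a history that is too short for the current time, so
  the length test removes it.
\<close>

lemma expectation_gsaw_step:
  assumes "length p \<le> Suc n"
  shows "measure_pmf.expectation (gsaw_step V adj p)
           (\<lambda>q. of_bool (length q = Suc (Suc n)) * trap_prob V adj l (set q) (hd q)) =
         of_bool (length p = Suc n) * trap_prob V adj (Suc l) (set p) (hd p)"
proof (cases "trapped V adj p")
  case True
  then show ?thesis
    using assms by (simp add: gsaw_step_def trapped_def unvisited_nbrs_eq_free_nbrs)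
next
  case False
  then show ?thesis
    using finite_unvisited_nbrs[of p]
    by (simp add: gsaw_step_def trapped_def integral_pmf_of_set unvisited_nbrs_eq_free_nbrs
          flip: sum_distrib_left)
qed

text \<open>
  The process unrolls at its end while \<open>trap_prob\<close> unrolls at its beginning; conditioning on the
  history at an intermediate time \<open>n\<close> lets the induction move steps from one to the other.
\<close>

lemma prob_gsaw_eq_expectation_trap_prob:
  "measure_pmf.prob (gsaw V adj v (n + l)) {p. length p = Suc (n + l) \<and> trapped V adj p} =
   measure_pmf.expectation (gsaw V adj v n)
     (\<lambda>p. of_bool (length p = Suc n) * trap_prob V adj l (set p) (hd p))"
proof (induction l arbitrary: n)
  case 0
  have "measure_pmf.prob (gsaw V adj v n) {p. length p = Suc n \<and> trapped V adj p} =
    measure_pmf.expectation (gsaw V adj v n)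
      (indicator {p. length p = Suc n \<and> trapped V adj p})"
    by simp
  also have "\<dots> = measure_pmf.expectation (gsaw V adj v n)
     (\<lambda>p. of_bool (length p = Suc n) * trap_prob V adj 0 (set p) (hd p))"
    by (rule Bochner_Integration.integral_cong)
       (auto simp: trapped_def unvisited_nbrs_eq_free_nbrs indicator_def)
  finally show ?case by simp
next
  case (Suc l)
  define f where
    "f = (\<lambda>q. of_bool (length q = Suc (Suc n)) * trap_prob V adj l (set q) (hd q))"
  define g where
    "g = (\<lambda>p. of_bool (length p = Suc n) * trap_prob V adj (Suc l) (set p) (hd p))"
  let ?M = "gsaw V adj v n"
  have "measure_pmf.expectation (gsaw V adj v (Suc n)) f =
      (\<Sum>p\<in>set_pmf ?M. pmf ?M p *\<^sub>R measure_pmf.expectation (gsaw_step V adj p) f)"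
    by (simp add: pmf_expectation_bind[OF finite_set_gsaw finite_set_gsaw_step order_refl])
  also have "\<dots> = (\<Sum>p\<in>set_pmf ?M. pmf ?M p *\<^sub>R g p)"
    using expectation_gsaw_step length_gsaw_le
    by (intro sum.cong refl) (simp add: f_def g_def del: trap_prob.simps)
  also have "\<dots> = measure_pmf.expectation ?M g"
    by (subst integral_measure_pmf[OF finite_set_gsaw]) auto
  finally show ?case
    using Suc.IH[of "Suc n"] unfolding f_def g_def by simp
qed

lemma gsaw_length_prob_eq_trap_prob: "gsaw_length_prob V adj v l = trap_prob V adj l {v} v"
  using prob_gsaw_eq_expectation_trap_prob[of v 0 l] by (simp add: gsaw_length_prob_def)

end

lemma free_nbrs_graph_iso:
  assumes bij: "bij_betw f V V'"
    and adj: "\<And>x y. x \<in> V \<Longrightarrow> y \<in> V \<Longrightarrow> adj' (f x) (f y) \<longleftrightarrow> adj x y"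
    and "U \<subseteq> V" "z \<in> V"
  shows "free_nbrs V' adj' (f ` U) (f z) = f ` free_nbrs V adj U z"
proof -
  have V': "V' = f ` V" and "inj_on f V" using bij by (simp_all add: bij_betw_def)
  then have mem: "f w \<in> f ` U \<longleftrightarrow> w \<in> U" if "w \<in> V" for w
    using that assms(3) by (meson inj_on_image_mem_iff)
  have "free_nbrs V' adj' (f ` U) (f z) = f ` {w \<in> V. adj' (f z) (f w) \<and> f w \<notin> f ` U}"
    unfolding free_nbrs_def V' by auto
  also have "{w \<in> V. adj' (f z) (f w) \<and> f w \<notin> f ` U} = free_nbrs V adj U z"
    unfolding free_nbrs_def using assms(4) by (simp add: adj mem cong: conj_cong)
  finally show ?thesis .
qed

text \<open>
  This is used for the projection of the ladder to the integers and for the reflections of the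
  integers.
\<close>

lemma trap_prob_graph_iso:
  assumes bij: "bij_betw f V V'"
    and adj: "\<And>x y. x \<in> V \<Longrightarrow> y \<in> V \<Longrightarrow> adj' (f x) (f y) \<longleftrightarrow> adj x y"
    and "U \<subseteq> V" "z \<in> V"
  shows "trap_prob V' adj' l (f ` U) (f z) = trap_prob V adj l U z"
  using assms(3,4)
proof (induction l arbitrary: U z)
  case 0
  have "free_nbrs V' adj' (f ` U) (f z) = f ` free_nbrs V adj U z"
    using bij adj 0 by (rule free_nbrs_graph_iso)
  then show ?case by simp
next
  case (Suc l)
  have nbrs: "free_nbrs V' adj' (f ` U) (f z) = f ` free_nbrs V adj U z"
    using bij adj Suc.prems by (rule free_nbrs_graph_iso)
  have inj: "inj_on f V" using bij by (simp add: bij_betw_def)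
  have sub: "free_nbrs V adj U z \<subseteq> V" by (auto simp: free_nbrs_def)
  have inj': "inj_on f (free_nbrs V adj U z)" using inj sub by (rule inj_on_subset)
  have "(\<Sum>w\<in>f ` free_nbrs V adj U z. trap_prob V' adj' l (insert w (f ` U)) w) =
      (\<Sum>w\<in>free_nbrs V adj U z. trap_prob V' adj' l (f ` insert w U) (f w))"
    by (simp add: sum.reindex[OF inj'])
  also have "\<dots> = (\<Sum>w\<in>free_nbrs V adj U z. trap_prob V adj l (insert w U) w)"
    using sub Suc.prems by (intro sum.cong refl Suc.IH) auto
  finally show ?case by (simp add: nbrs card_image[OF inj'])
qed

section \<open>The triangular ladder as the square of the bi-infinite path\<close>

definition near :: "int \<Rightarrow> int \<Rightarrow> bool" where
  "near x y \<longleftrightarrow> y \<in> {x - 2, x - 1, x + 1, x + 2}"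

abbreviation line_prob :: "nat \<Rightarrow> int set \<Rightarrow> int \<Rightarrow> real" where
  "line_prob \<equiv> trap_prob UNIV near"

lemma gsaw_length_prob_tri_ladder:
  assumes "v \<in> tri_ladder_verts"
  shows "gsaw_length_prob tri_ladder_verts tri_ladder_adj v l = line_prob l {fst v} (fst v)"
proof -
  have fin: "finite {w \<in> tri_ladder_verts. tri_ladder_adj z w}" for z
  proof (rule finite_subset)
    have "\<bar>fst z - fst w\<bar> \<le> 2" if "tri_ladder_adj z w" for w
      using that by (cases z; cases w) (simp add: tri_ladder_adj_def; linarith)
    then show "{w \<in> tri_ladder_verts. tri_ladder_adj z w} \<subseteq> {fst z - 2..fst z + 2} \<times> {0, 1}"
      by (force simp: tri_ladder_verts_def abs_le_iff)
  qed simp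
  \<comment> \<open>The second coordinate is the parity of the first one.\<close>
  have bij: "bij_betw fst tri_ladder_verts UNIV"
  proof (rule bij_betwI[where g = "\<lambda>a. (a, a mod 2)"])
    show "(\<lambda>a. (a, a mod 2)) \<in> UNIV \<rightarrow> tri_ladder_verts"
      by (auto simp: tri_ladder_verts_def)
  qed (auto simp: tri_ladder_verts_def mod_2_eq_odd)
  have adj: "near (fst x) (fst y) \<longleftrightarrow> tri_ladder_adj x y"
    if "x \<in> tri_ladder_verts" "y \<in> tri_ladder_verts" for x y
    using that unfolding tri_ladder_verts_def near_def tri_ladder_adj_def
    by (auto split: prod.splits)
  have "line_prob l (fst ` {v}) (fst v) = trap_prob tri_ladder_verts tri_ladder_adj l {v} v"
    by (rule trap_prob_graph_iso) (use bij adj assms in auto)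
  then show ?thesis
    by (simp add: gsaw_length_prob_eq_trap_prob[OF fin])
qed

lemma free_nbrs_near: "free_nbrs UNIV near U z = {z - 2, z - 1, z + 1, z + 2} - U"
  by (auto simp: free_nbrs_def near_def)

lemma line_prob_reflect: "line_prob l ((\<lambda>j. c - j) ` U) (c - z) = line_prob l U z"
proof (rule trap_prob_graph_iso[where f = "\<lambda>j. c - j"])
  show "bij_betw (\<lambda>j. c - j) UNIV UNIV"
    by (rule bij_betwI[where g = "\<lambda>j. c - j"]) auto
next
  show "near (c - x) (c - y) \<longleftrightarrow> near x y" for x y
    unfolding near_def insert_iff empty_iff by linarith
qed simp_all

section \<open>Generating functions of the configurations\<close>

text \<open>
  The five series below, three of them with a parameter \<open>e\<close>, are the solution of the linear
  system in \<open>fresh_gf_eq\<close>, \<open>one_gap_gf_eq\<close>, \<open>gapped_gf_eq\<close>, \<open>sidestep_gf_eq\<close> and \<open>turn_gf_eq\<close>. The geometric series with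
  ratio \<open>x/3\<close> contributes no pole at 3 to \<open>gapped_gf\<close>, because it is multiplied by \<open>fresh_gf\<close>, which
  has the factor \<open>3 - x\<close>.
\<close>

definition quartic :: "real fps" where
  "quartic = fps_X ^ 4 - 6 * fps_X ^ 3 + 2 * fps_X ^ 2 - 30 * fps_X + 36"

definition inv_denom :: "real fps" where
  "inv_denom = inverse ((3 - fps_X ^ 2) * quartic)"

definition fresh_gf :: "real fps" where
  "fresh_gf = fps_X ^ 3 * (2 + fps_X) * (3 - fps_X) * inv_denom"

definition one_gap_gf :: "real fps" where
  "one_gap_gf = fps_X ^ 2 * (2 + fps_X) * (2 - fps_X) * (3 - fps_X) * inv_denom"

definition gapped_gf :: "real fps \<Rightarrow> real fps" where
  "gapped_gf e = fps_const (1 / 6) *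
     (fps_X ^ 4 * (4 + 3 * fps_X) * (2 + fps_X) + fps_X ^ 2 * e * (3 + 2 * fps_X) * quartic) *
     inv_denom"

definition sidestep_gf :: "real fps \<Rightarrow> real fps" where
  "sidestep_gf e = 2 * fps_const (1 / 6) * fps_X * (e + fresh_gf + one_gap_gf)"

definition turn_gf :: "real fps \<Rightarrow> real fps" where
  "turn_gf e = 3 * fps_const (1 / 6) * fps_X * (fresh_gf + e)"

lemma inv_denom: "(3 - fps_X ^ 2) * quartic * inv_denom = 1"
  unfolding inv_denom_def by (rule inverse_mult_eq_1') (simp add: quartic_def)

lemma six_sixths: "6 * fps_const (1 / 6 :: real) = 1"
  by (simp add: numeral_fps_const)

lemma fresh_gf_eq: "2 * fresh_gf = fps_X * (fresh_gf + one_gap_gf)"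
  unfolding fresh_gf_def one_gap_gf_def by algebra

lemma sidestep_gf_eq: "3 * sidestep_gf e = fps_X * (e + fresh_gf + one_gap_gf)"
proof -
  have "3 * sidestep_gf e = (6 * fps_const (1 / 6)) * (fps_X * (e + fresh_gf + one_gap_gf))"
    unfolding sidestep_gf_def by (simp only: ac_simps) simp
  then show ?thesis by (simp only: six_sixths mult_1)
qed

lemma turn_gf_eq: "2 * turn_gf e = fps_X * (fresh_gf + e)"
proof -
  have "2 * turn_gf e = (6 * fps_const (1 / 6)) * (fps_X * (fresh_gf + e))"
    unfolding turn_gf_def by (simp only: ac_simps) simp
  then show ?thesis by (simp only: six_sixths mult_1)
qed

lemma one_gap_gf_eq:
  "3 * one_gap_gf = fps_X * (fps_X * fresh_gf + sidestep_gf 1 + gapped_gf 1)"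
proof -
  have "3 * (x^2 * (2 + x) * (2 - x) * (3 - x) * w) =
      x * (x * (x^3 * (2 + x) * (3 - x) * w)
        + 2 * h * x * (1 + x^3 * (2 + x) * (3 - x) * w + x^2 * (2 + x) * (2 - x) * (3 - x) * w)
        + h * (x^4 * (4 + 3 * x) * (2 + x) + x^2 * 1 * (3 + 2 * x) *
            (x^4 - 6 * x^3 + 2 * x^2 - 30 * x + 36)) * w)"
    if "(3 - x^2) * (x^4 - 6 * x^3 + 2 * x^2 - 30 * x + 36) * w = 1" "6 * h = 1"
    for x w h :: "real fps"
    using that by algebra
  from this[OF inv_denom[unfolded quartic_def] six_sixths] show ?thesis
    unfolding fresh_gf_def one_gap_gf_def sidestep_gf_def gapped_gf_def quartic_def .
qed

lemma gapped_gf_eq: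
  "3 * gapped_gf e = fps_X * (turn_gf e + sidestep_gf (fps_X * e) + gapped_gf (fps_X * e))"
proof -
  have "3 * (h * (x^4 * (4 + 3 * x) * (2 + x) + x^2 * e * (3 + 2 * x) *
            (x^4 - 6 * x^3 + 2 * x^2 - 30 * x + 36)) * w) =
      x * (3 * h * x * (x^3 * (2 + x) * (3 - x) * w + e)
        + 2 * h * x * (x * e + x^3 * (2 + x) * (3 - x) * w
            + x^2 * (2 + x) * (2 - x) * (3 - x) * w)
        + h * (x^4 * (4 + 3 * x) * (2 + x) + x^2 * (x * e) * (3 + 2 * x) *
            (x^4 - 6 * x^3 + 2 * x^2 - 30 * x + 36)) * w)"
    if "(3 - x^2) * (x^4 - 6 * x^3 + 2 * x^2 - 30 * x + 36) * w = 1" "6 * h = 1"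
    for x w h :: "real fps"
    using that by algebra
  from this[OF inv_denom[unfolded quartic_def] six_sixths] show ?thesis
    unfolding fresh_gf_def one_gap_gf_def sidestep_gf_def turn_gf_def gapped_gf_def quartic_def .
qed

lemma coeff_0_of_eq_X_mult:
  fixes f g :: "real fps"
  assumes "numeral k * f = fps_X * g"
  shows "f $ 0 = 0"
  using arg_cong[OF assms, of "\<lambda>h. h $ 0"] by simp

lemma coeff_Suc_of_eq_X_mult:
  fixes f g :: "real fps"
  assumes "numeral k * f = fps_X * g"
  shows "f $ Suc l = g $ l / numeral k"
  using arg_cong[OF assms, of "\<lambda>h. h $ Suc l"] by (simp add: numeral_fps_const field_simps)

section \<open>The configurations of the walk\<close>

text \<open>All configurations are oriented such that the frontier is on the right.\<close>

definition clear_ahead :: "int set \<Rightarrow> int \<Rightarrow> bool" where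
  "clear_ahead U n \<longleftrightarrow> (\<forall>j>n. j \<notin> U)"

text \<open>
  A walk that arrives at \<open>m\<close> with \<open>m + 1\<close> and \<open>m + 2\<close> visited can never return to the right of \<open>m\<close>,
  so only the part of the visited set below \<open>m\<close> matters for its future. Quantifying over all visited
  sets \<open>U'\<close> with the same part below \<open>m\<close> makes the predicate stable while the frontier moves on.
\<close>

definition retreat :: "int set \<Rightarrow> int \<Rightarrow> real fps \<Rightarrow> bool" where
  "retreat U m e \<longleftrightarrow>
     (\<forall>U' l. (\<forall>j<m. j \<in> U' \<longleftrightarrow> j \<in> U) \<longrightarrow> {m, m + 1, m + 2} \<subseteq> U' \<longrightarrow> line_prob l U' m = e $ l)"

definition fresh :: "int set \<Rightarrow> int \<Rightarrow> bool" where
  "fresh U n \<longleftrightarrow> clear_ahead U n \<and> {n - 2, n - 1, n} \<subseteq> U"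

definition one_gap :: "int set \<Rightarrow> int \<Rightarrow> bool" where
  "one_gap U n \<longleftrightarrow> clear_ahead U n \<and> {n - 3, n - 2, n} \<subseteq> U \<and> n - 1 \<notin> U"

text \<open>
  Here \<open>e\<close> describes the walk after it has turned back into the gap \<open>n - 1\<close> and gone on to \<open>n - 3\<close>.
  The vertex \<open>n - 3\<close> is either the next gap of the chain or the first vertex to the left of the start.
\<close>

definition gapped :: "int set \<Rightarrow> int \<Rightarrow> real fps \<Rightarrow> bool" where
  "gapped U n e \<longleftrightarrow>
     clear_ahead U n \<and> {n - 2, n} \<subseteq> U \<and> n - 1 \<notin> U \<and> n - 3 \<notin> U \<and> retreat U (n - 3) e"

definition sidestep :: "int set \<Rightarrow> int \<Rightarrow> real fps \<Rightarrow> bool" where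
  "sidestep U n e \<longleftrightarrow>
     clear_ahead U n \<and> {n - 1, n} \<subseteq> U \<and> n - 2 \<notin> U \<and> retreat U (n - 2) e"

definition turn :: "int set \<Rightarrow> int \<Rightarrow> real fps \<Rightarrow> bool" where
  "turn U n e \<longleftrightarrow>
     clear_ahead U (n + 1) \<and> {n - 1, n, n + 1} \<subseteq> U \<and> n - 2 \<notin> U \<and> retreat U (n - 2) e"

text \<open>
  Turning back into a single gap differs from \<open>turn\<close>: the wall blocks the retreat, and the only free
  neighbour is the one in front of the frontier.
\<close>

definition dead_turn :: "int set \<Rightarrow> int \<Rightarrow> bool" where
  "dead_turn U n \<longleftrightarrow> clear_ahead U (n + 1) \<and> {n - 2, n - 1, n, n + 1} \<subseteq> U"

lemma retreat_line_prob:
  assumes "retreat U m e" "{m + 1, m + 2} \<subseteq> U"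
  shows "line_prob l (insert m U) m = e $ l"
  using assms unfolding retreat_def by auto

lemma retreat_cong:
  assumes "retreat U m e" "\<And>j. j < m \<Longrightarrow> j \<in> W \<longleftrightarrow> j \<in> U"
  shows "retreat W m e"
  using assms unfolding retreat_def by simp

lemma retreat_dead_end:
  assumes "{m - 2, m - 1} \<subseteq> U"
  shows "retreat U m 1"
  unfolding retreat_def
proof (intro allI impI)
  fix U' l assume U': "\<forall>j<m. j \<in> U' \<longleftrightarrow> j \<in> U" "{m, m + 1, m + 2} \<subseteq> U'"
  then have "free_nbrs UNIV near U' m = {}"
    using assms by (simp add: free_nbrs_near)
  then show "line_prob l U' m = 1 $ l"
    by (cases l) simp_all
qed

text \<open>
  In a gap whose neighbours to the right are visited, the step to the next gap is forced; it costs
  one factor \<open>x\<close>.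
\<close>

lemma retreat_next_gap:
  assumes "retreat U m e" "m \<notin> U" "m + 1 \<in> U"
  shows "retreat U (m + 2) (fps_X * e)"
  unfolding retreat_def
proof (intro allI impI)
  fix U' l assume U': "\<forall>j<m + 2. j \<in> U' \<longleftrightarrow> j \<in> U" "{m + 2, m + 2 + 1, m + 2 + 2} \<subseteq> U'"
  have "m \<notin> U'" "m + 1 \<in> U'" using U'(1) assms by auto
  then have nbrs: "free_nbrs UNIV near U' (m + 2) = {m}"
    using U'(2) by (auto simp: free_nbrs_near add.commute)
  have "line_prob l (insert m U') m = e $ l" for l
    using retreat_line_prob[OF retreat_cong[OF assms(1), of U']] U' \<open>m + 1 \<in> U'\<close> by simp
  then show "line_prob l U' (m + 2) = (fps_X * e) $ l"
    by (cases l) (simp_all add: nbrs)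
qed

lemma fresh_insert:
  assumes "clear_ahead U n" "{n - 1, n} \<subseteq> U"
  shows "fresh (insert (n + 1) U) (n + 1)"
  using assms by (auto simp: fresh_def clear_ahead_def)

lemma one_gap_insert:
  assumes "clear_ahead U n" "{n - 1, n} \<subseteq> U"
  shows "one_gap (insert (n + 2) U) (n + 2)"
  using assms by (auto simp: one_gap_def clear_ahead_def)

lemma gapped_insert:
  assumes "clear_ahead U n" "n \<in> U" "n - 1 \<notin> U" "retreat U (n - 1) e"
  shows "gapped (insert (n + 2) U) (n + 2) e"
  using assms retreat_cong[of U "n - 1" e "insert (n + 2) U"]
  by (auto simp: gapped_def clear_ahead_def)

lemma sidestep_insert:
  assumes "clear_ahead U n" "n \<in> U" "n - 1 \<notin> U" "retreat U (n - 1) e"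
  shows "sidestep (insert (n + 1) U) (n + 1) e"
  using assms retreat_cong[of U "n - 1" e "insert (n + 1) U"]
  by (auto simp: sidestep_def clear_ahead_def)

lemma turn_insert:
  assumes "gapped U n e"
  shows "turn (insert (n - 1) U) (n - 1) e"
  using assms retreat_cong[of U "n - 3" e "insert (n - 1) U"]
  by (auto simp: turn_def gapped_def clear_ahead_def)

lemma dead_turn_insert:
  assumes "one_gap U n"
  shows "dead_turn (insert (n - 1) U) (n - 1)"
  using assms by (auto simp: dead_turn_def one_gap_def clear_ahead_def)

lemma retreat_gapped:
  assumes "gapped U n e"
  shows "retreat U (n - 1) (fps_X * e)"
  using assms retreat_next_gap[of U "n - 3" e] by (simp add: gapped_def)

lemma retreat_one_gap:
  assumes "one_gap U n"
  shows "retreat U (n - 1) 1"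
  using assms retreat_dead_end[of "n - 1" U] by (simp add: one_gap_def)

lemma free_nbrs_fresh: "fresh U n \<Longrightarrow> free_nbrs UNIV near U n = {n + 1, n + 2}"
  by (auto simp: free_nbrs_near fresh_def clear_ahead_def)

lemma free_nbrs_one_gap: "one_gap U n \<Longrightarrow> free_nbrs UNIV near U n = {n - 1, n + 1, n + 2}"
  by (auto simp: free_nbrs_near one_gap_def clear_ahead_def)

lemma free_nbrs_gapped: "gapped U n e \<Longrightarrow> free_nbrs UNIV near U n = {n - 1, n + 1, n + 2}"
  by (auto simp: free_nbrs_near gapped_def clear_ahead_def)

lemma free_nbrs_sidestep: "sidestep U n e \<Longrightarrow> free_nbrs UNIV near U n = {n - 2, n + 1, n + 2}"
  by (auto simp: free_nbrs_near sidestep_def clear_ahead_def)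

lemma free_nbrs_turn: "turn U n e \<Longrightarrow> free_nbrs UNIV near U n = {n - 2, n + 2}"
  by (auto simp: free_nbrs_near turn_def clear_ahead_def)

lemma free_nbrs_dead_turn: "dead_turn U n \<Longrightarrow> free_nbrs UNIV near U n = {n + 2}"
  by (auto simp: free_nbrs_near dead_turn_def clear_ahead_def)

lemmas free_nbrs_configs =
  free_nbrs_fresh free_nbrs_one_gap free_nbrs_gapped free_nbrs_sidestep free_nbrs_turn
  free_nbrs_dead_turn

lemmas gf_eqs = fresh_gf_eq one_gap_gf_eq gapped_gf_eq sidestep_gf_eq turn_gf_eq

text \<open>
  The six configurations only lead to each other or to a retreat, whose series is known. As every
  equation of the linear system has a factor \<open>x\<close> on its right-hand side, it expresses a coefficient
  by those of the next lower index, which is what the induction on the length needs. The series \<open>e\<close>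
  has to stay arbitrary, since an advance by 2 turns it into \<open>x e\<close>.
\<close>

lemma line_prob_configs:
  "(\<forall>U n. fresh U n \<longrightarrow> line_prob l U n = fresh_gf $ l) \<and>
   (\<forall>U n. one_gap U n \<longrightarrow> line_prob l U n = one_gap_gf $ l) \<and>
   (\<forall>U n e. gapped U n e \<longrightarrow> line_prob l U n = gapped_gf e $ l) \<and>
   (\<forall>U n e. sidestep U n e \<longrightarrow> line_prob l U n = sidestep_gf e $ l) \<and>
   (\<forall>U n e. turn U n e \<longrightarrow> line_prob l U n = turn_gf e $ l) \<and>
   (\<forall>U n. dead_turn U n \<longrightarrow> line_prob l U n = (fps_X * fresh_gf) $ l)"
proof (induction l)
  case 0
  show ?case
    using gf_eqs[THEN coeff_0_of_eq_X_mult] by (simp add: free_nbrs_configs)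
next
  case (Suc l)
  note IH = Suc.IH[THEN conjunct1, rule_format]
    Suc.IH[THEN conjunct2, THEN conjunct1, rule_format]
    Suc.IH[THEN conjunct2, THEN conjunct2, THEN conjunct1, rule_format]
    Suc.IH[THEN conjunct2, THEN conjunct2, THEN conjunct2, THEN conjunct1, rule_format]
    Suc.IH[THEN conjunct2, THEN conjunct2, THEN conjunct2, THEN conjunct2, THEN conjunct1,
      rule_format]
    Suc.IH[THEN conjunct2, THEN conjunct2, THEN conjunct2, THEN conjunct2, THEN conjunct2,
      rule_format]
  note forward = IH(1)[OF fresh_insert] IH(2)[OF one_gap_insert]
  note spread = IH(3)[OF gapped_insert] IH(4)[OF sidestep_insert]
  show ?case
  proof (intro conjI allI impI)
    fix U n assume c: "fresh U n"
    then have "clear_ahead U n" "{n - 1, n} \<subseteq> U" by (simp_all add: fresh_def)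
    then show "line_prob (Suc l) U n = fresh_gf $ Suc l"
      by (simp add: free_nbrs_fresh[OF c] forward coeff_Suc_of_eq_X_mult[OF fresh_gf_eq])
  next
    fix U n assume c: "one_gap U n"
    then have "clear_ahead U n" "n \<in> U" "n - 1 \<notin> U" by (simp_all add: one_gap_def)
    note * = this retreat_one_gap[OF c]
    show "line_prob (Suc l) U n = one_gap_gf $ Suc l"
      by (simp add: free_nbrs_one_gap[OF c] spread[OF *] IH(6)[OF dead_turn_insert[OF c]]
          coeff_Suc_of_eq_X_mult[OF one_gap_gf_eq] del: fps_X_mult_nth)
  next
    fix U n and e :: "real fps" assume c: "gapped U n e"
    then have "clear_ahead U n" "n \<in> U" "n - 1 \<notin> U" by (simp_all add: gapped_def)
    note * = this retreat_gapped[OF c]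
    show "line_prob (Suc l) U n = gapped_gf e $ Suc l"
      by (simp add: free_nbrs_gapped[OF c] spread[OF *] IH(5)[OF turn_insert[OF c]]
          coeff_Suc_of_eq_X_mult[OF gapped_gf_eq])
  next
    fix U n and e :: "real fps" assume c: "sidestep U n e"
    then have *: "clear_ahead U n" "{n - 1, n} \<subseteq> U" by (simp_all add: sidestep_def)
    have "line_prob l (insert (n - 2) U) (n - 2) = e $ l"
      using c by (intro retreat_line_prob) (simp_all add: sidestep_def)
    with * show "line_prob (Suc l) U n = sidestep_gf e $ Suc l"
      by (simp add: free_nbrs_sidestep[OF c] forward coeff_Suc_of_eq_X_mult[OF sidestep_gf_eq])
  next
    fix U n and e :: "real fps" assume c: "turn U n e"
    have "line_prob l (insert (n - 2) U) (n - 2) = e $ l"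
      using c by (intro retreat_line_prob) (simp_all add: turn_def)
    moreover have "line_prob l (insert (n + 2) U) (n + 2) = fresh_gf $ l"
      using c forward(1)[of U "n + 1"] by (simp add: turn_def add.commute)
    ultimately show "line_prob (Suc l) U n = turn_gf e $ Suc l"
      by (simp add: free_nbrs_turn[OF c] coeff_Suc_of_eq_X_mult[OF turn_gf_eq])
  next
    fix U n assume c: "dead_turn U n"
    then have "line_prob l (insert (n + 2) U) (n + 2) = fresh_gf $ l"
      using forward(1)[of U "n + 1"] by (simp add: dead_turn_def add.commute)
    then show "line_prob (Suc l) U n = (fps_X * fresh_gf) $ Suc l"
      by (simp add: free_nbrs_dead_turn[OF c])
  qed
qed

lemmas line_prob_fresh = line_prob_configs[THEN conjunct1, rule_format]
lemmas line_prob_gapped =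
  line_prob_configs[THEN conjunct2, THEN conjunct2, THEN conjunct1, rule_format]
lemmas line_prob_sidestep =
  line_prob_configs[THEN conjunct2, THEN conjunct2, THEN conjunct2, THEN conjunct1, rule_format]

section \<open>The start of the walk and the solution\<close>

text \<open>
  The escape into the untouched half-line: the two visited vertices \<open>m + 1\<close> and \<open>m + 2\<close> are a wall, so
  in the mirror image the walk stands at a fresh frontier.
\<close>

lemma retreat_past_start:
  assumes "\<And>j. j \<le> m \<Longrightarrow> j \<notin> U"
  shows "retreat U m fresh_gf"
  unfolding retreat_def
proof (intro allI impI)
  fix U' l assume U': "\<forall>j<m. j \<in> U' \<longleftrightarrow> j \<in> U" "{m, m + 1, m + 2} \<subseteq> U'"
  have mem: "j \<in> (\<lambda>j. 0 - j) ` U' \<longleftrightarrow> - j \<in> U'" for j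
    by (auto simp: image_iff) (metis minus_minus)
  have "fresh ((\<lambda>j. 0 - j) ` U') (0 - m)"
    unfolding fresh_def clear_ahead_def mem insert_subset using U' assms by (auto simp: add.commute)
  then show "line_prob l U' m = fresh_gf $ l"
    using line_prob_reflect[of l 0 U' m] line_prob_fresh by simp
qed

text \<open>
  The start resembles the front end of a chain of gaps: after the first step to the right, the
  vertex \<open>n - 1\<close> can be reached only by turning back, and then the walk escapes to the left.
  Reflection at \<open>n\<close> treats the two first steps to the left.
\<close>

lemma line_prob_start:
  "line_prob (Suc l) {n} n = (sidestep_gf fresh_gf $ l + gapped_gf fresh_gf $ l) / 2"
proof -
  have start: "clear_ahead {n} n" "n \<in> {n}" "n - 1 \<notin> {n}" "retreat {n} (n - 1) fresh_gf"
    by (auto simp: clear_ahead_def intro: retreat_past_start)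
  have right: "line_prob l {n, n + 1} (n + 1) = sidestep_gf fresh_gf $ l"
      "line_prob l {n, n + 2} (n + 2) = gapped_gf fresh_gf $ l"
    using line_prob_sidestep[OF sidestep_insert[OF start], of l]
      line_prob_gapped[OF gapped_insert[OF start], of l] by (simp_all add: insert_commute)
  have left: "line_prob l {n, n - 1} (n - 1) = sidestep_gf fresh_gf $ l"
      "line_prob l {n, n - 2} (n - 2) = gapped_gf fresh_gf $ l"
    using right line_prob_reflect[of l "2 * n" "{n, n + 1}" "n + 1"]
      line_prob_reflect[of l "2 * n" "{n, n + 2}" "n + 2"] by (simp_all add: algebra_simps)
  have "free_nbrs UNIV near {n} n = {n - 2, n - 1, n + 1, n + 2}"
    by (auto simp: free_nbrs_near)
  then show ?thesis
    using left right by (simp add: insert_commute)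
qed

lemma line_prob_start_0: "line_prob 0 {n} n = 0"
  by (simp add: free_nbrs_near)

theorem theorem2p44:
  fixes v :: "int \<times> int"
  assumes "v \<in> tri_ladder_verts"
  shows "(Abs_fps (\<lambda>l. gsaw_length_prob tri_ladder_verts tri_ladder_adj v l) :: real fps) =
    (fps_X ^ 4 * (2 + fps_X) * (12 + 6 * fps_X - fps_X ^ 3 - fps_X ^ 4)) /
    (4 * (fps_X ^ 2 - 3) ^ 2 *
      (fps_X ^ 4 - 6 * fps_X ^ 3 + 2 * fps_X ^ 2 - 30 * fps_X + 36))"
  (is "?S = ?num / ?den")
proof -
  have first_step: "2 * ?S = fps_X * (sidestep_gf fresh_gf + gapped_gf fresh_gf)"
  proof (rule fps_ext)
    fix l
    show "(2 * ?S) $ l = (fps_X * (sidestep_gf fresh_gf + gapped_gf fresh_gf)) $ l"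
      by (cases l) (simp_all add: gsaw_length_prob_tri_ladder[OF assms] line_prob_start
          line_prob_start_0 numeral_fps_const del: trap_prob.simps)
  qed
  have solve: "s * (4 * (x^2 - 3)^2 * q) = x^4 * (2 + x) * (12 + 6 * x - x^3 - x^4)"
    if w: "(3 - x^2) * q * w = 1" and h: "6 * h = 1"
      and a: "a = x^3 * (2 + x) * (3 - x) * w"
      and b: "b = x^2 * (2 + x) * (2 - x) * (3 - x) * w"
      and s: "2 * s = x * (2 * h * x * (a + a + b)
        + h * (x^4 * (4 + 3 * x) * (2 + x) + x^2 * a * (3 + 2 * x) * q) * w)"
    for x w h a b s q :: "real fps"
  proof -
    \<comment> \<open>The factor \<open>?p * q\<close> clears \<open>w\<close>, and a second \<open>?p\<close> clears the product of \<open>a\<close> with \<open>w\<close>.\<close>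
    let ?p = "3 - x^2"
    let ?K = "x^4 * (4 + 3 * x) * (2 + x)"
    have a': "?p * q * a = x^3 * (2 + x) * (3 - x)"
      using w a by algebra
    have b': "?p * q * b = x^2 * (2 + x) * (2 - x) * (3 - x)"
      using w b by algebra
    have "12 * s = x * (2 * x * (a + a + b) + (?K + x^2 * a * (3 + 2 * x) * q) * w)"
      using s h by algebra
    then have "?p * (?p * q) * (12 * s) =
        ?p * (?p * q) * (x * (2 * x * (a + a + b) + (?K + x^2 * a * (3 + 2 * x) * q) * w))"
      by simp
    also have "\<dots> = x * (2 * x * ?p * (2 * (?p * q * a) + ?p * q * b)
        + (?p * ?K + x^2 * (3 + 2 * x) * (?p * q * a)) * (?p * q * w))"
      by algebra
    also have "\<dots> = 3 * (x^4 * (2 + x) * (12 + 6 * x - x^3 - x^4))"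
      unfolding w a' b' by algebra
    finally have "?p * (?p * q) * (12 * s) = 3 * (x^4 * (2 + x) * (12 + 6 * x - x^3 - x^4))" .
    then have "3 * (s * (4 * (x^2 - 3)^2 * q)) = 3 * (x^4 * (2 + x) * (12 + 6 * x - x^3 - x^4))"
      by algebra
    then show ?thesis by (rule mult_left_cancel[THEN iffD1, OF numeral_neq_zero])
  qed
  have "?S * ?den = ?num"
    using solve[OF inv_denom six_sixths fresh_gf_def one_gap_gf_def
        first_step[unfolded sidestep_gf_def gapped_gf_def]]
    unfolding quartic_def .
  moreover have "?den $ 0 \<noteq> 0" by simp
  then have "?den \<noteq> 0" by force
  ultimately show ?thesis by (metis nonzero_mult_div_cancel_right)
qed

end
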